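(* Let $G$ be a finite nilpotent group. Then the co-prime graph $\Gamma(G)$ is AT-free if and only if $|\pi(G)|<3$.
   Context: For a finite group $G$, the co-prime graph $\Gamma(G)$ is the simple undirected graph with vertex set $G$ (including the identity) in which two distinct vertices $x,y$ are adjacent if and only if $\gcd(o(x),o(y))=1$, where $o(g)$ denotes the order of $g$. $\pi(G)$ denotes the set of prime divisors of $|G|$. An asteroidal triple (AT) in a graph is an independent set of three (distinct) vertices such that between each pair of them there is a path which does not contain any neighbour of the third. A graph is AT-free if it contains no asteroidal triple. *)

theory Defs
  imports "HOL-Algebra.Algebra" "Graph_Theory.Graph_Theory"
begin

definition commutator_subgroup ::
    "('a, 'b) monoid_scheme \<Rightarrow> 'a set \<Rightarrow> 'a set \<Rightarrow> 'a set" where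
  "commutator_subgroup G H K =
     generate G (\<Union>h\<in>H. \<Union>k\<in>K. {h \<otimes>\<^bsub>G\<^esub> k \<otimes>\<^bsub>G\<^esub> inv\<^bsub>G\<^esub> h \<otimes>\<^bsub>G\<^esub> inv\<^bsub>G\<^esub> k})"

text \<open>The lower central series, indexed so that the term with index \<open>0\<close> is the whole group.\<close>

primrec lower_central :: "('a, 'b) monoid_scheme \<Rightarrow> nat \<Rightarrow> 'a set" where
  "lower_central G 0 = carrier G"
| "lower_central G (Suc n) = commutator_subgroup G (lower_central G n) (carrier G)"

definition nilpotent_group :: "('a, 'b) monoid_scheme \<Rightarrow> bool" where
  "nilpotent_group G \<longleftrightarrow> group G \<and> (\<exists>n. lower_central G n = {\<one>\<^bsub>G\<^esub>})"

definition prime_divisors_of_order :: "('a, 'b) monoid_scheme \<Rightarrow> nat set" where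
  "prime_divisors_of_order G = {p. Factorial_Ring.prime p \<and> p dvd order G}"

text \<open>
  A simple undirected graph is represented as a symmetric loop-free digraph without parallel
  arcs, an edge being a pair of opposite arcs.
\<close>

definition coprime_graph :: "('a, 'b) monoid_scheme \<Rightarrow> 'a pair_pre_digraph" where
  "coprime_graph G =
     \<lparr> pverts = carrier G,
       parcs = {(x, y). x \<in> carrier G \<and> y \<in> carrier G \<and> x \<noteq> y \<and>
                        coprime (group.ord G x) (group.ord G y)} \<rparr>"

lemma pair_graph_coprime_graph:
  assumes "finite (carrier G)"
  shows "pair_graph (coprime_graph G)"
proof -
  have fin: "finite (parcs (coprime_graph G))"
    by (rule finite_subset[of _ "carrier G \<times> carrier G"])
       (use assms in \<open>auto simp: coprime_graph_def\<close>)
  show ?thesis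
    using assms fin
    by unfold_locales
       (auto simp: coprime_graph_def symmetric_def sym_def coprime_commute)
qed

text \<open>The following notions are meant for symmetric digraphs, where neighbours have no direction.\<close>

definition independent_set :: "('a, 'b) pre_digraph \<Rightarrow> 'a set \<Rightarrow> bool" where
  "independent_set \<Gamma> S \<longleftrightarrow> S \<subseteq> verts \<Gamma> \<and> (\<forall>u\<in>S. \<forall>v\<in>S. (u, v) \<notin> arcs_ends \<Gamma>)"

definition path_avoiding_neighbours ::
    "('a, 'b) pre_digraph \<Rightarrow> 'a \<Rightarrow> 'a \<Rightarrow> 'a \<Rightarrow> bool" where
  "path_avoiding_neighbours \<Gamma> x y z \<longleftrightarrow>
     (\<exists>p. vpath p \<Gamma> \<and> hd p = x \<and> last p = y \<and> (\<forall>w\<in>set p. (z, w) \<notin> arcs_ends \<Gamma>))"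

definition asteroidal_triple :: "('a, 'b) pre_digraph \<Rightarrow> 'a \<Rightarrow> 'a \<Rightarrow> 'a \<Rightarrow> bool" where
  "asteroidal_triple \<Gamma> x y z \<longleftrightarrow>
     distinct [x, y, z] \<and> independent_set \<Gamma> {x, y, z} \<and>
     path_avoiding_neighbours \<Gamma> x y z \<and>
     path_avoiding_neighbours \<Gamma> y z x \<and>
     path_avoiding_neighbours \<Gamma> x z y"

definition AT_free :: "('a, 'b) pre_digraph \<Rightarrow> bool" where
  "AT_free \<Gamma> \<longleftrightarrow> \<not> (\<exists>x y z. asteroidal_triple \<Gamma> x y z)"

end

theory Submission
  imports Defs
begin

text \<open>
  Nilpotency provides that elements of coprime orders commute
  (\<open>nilpotent_coprime_ord_commute\<close>): their commutator is central modulo the next term of the lower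
  central series whenever it lies in a term of the series, and a central commutator is killed by
  the orders of both elements.

  Suppose that three distinct primes \<open>p\<close>, \<open>q\<close>, \<open>r\<close> divide the order of \<open>G\<close>, and let \<open>a\<close>, \<open>b\<close>,
  \<open>c\<close> have these orders. The three elements commute, so the products \<open>ab\<close>, \<open>bc\<close>, \<open>ca\<close> have
  orders \<open>pq\<close>, \<open>qr\<close>, \<open>rp\<close>. Any two of these share a prime, so the products are independent. The
  path \<open>ab\<close>, \<open>c\<close>, \<open>a\<close>, \<open>bc\<close> contains no neighbour of \<open>ca\<close>, because the order of each of its
  vertices is divisible by \<open>r\<close> or \<open>p\<close>; the other two paths are obtained by permuting the primes.
  Hence \<open>ab\<close>, \<open>bc\<close>, \<open>ca\<close> is an asteroidal triple (\<open>three_primes_imp_asteroidal_triple\<close>).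

  Conversely, an asteroidal triple \<open>x\<close>, \<open>y\<close>, \<open>z\<close> exhibits three primes
  (\<open>asteroidal_triple_imp_three_primes\<close>). The second vertex \<open>w\<close> of the path from \<open>y\<close> that avoids
  the neighbours of \<open>x\<close> has order coprime to that of \<open>y\<close> but not to that of \<open>x\<close>. So the order of
  \<open>x\<close> has one prime in common with that of \<open>y\<close> and a different one in common with that of \<open>w\<close>.
  The second vertex \<open>w'\<close> of the path from \<open>x\<close> that avoids the neighbours of \<open>z\<close> has order coprime
  to that of \<open>x\<close>, and it is not the identity, since its order has a factor in common with that of
  \<open>z\<close>. A prime divisor of the order of \<open>w'\<close> is therefore a third one.
\<close>

section \<open>Elements of coprime orders in a nilpotent group\<close>

text \<open>
  The element \<open>c\<close> is the commutator \<open>[a, b] = a b a\<^sup>-\<^sup>1 b\<^sup>-\<^sup>1\<close>. The identity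
  \<open>[a, b\<^sup>n] = [a, b]\<^sup>n\<close>, valid when \<open>[a, b]\<close> commutes with \<open>b\<close>, is written without inverses so
  that the induction only moves \<open>a\<close> and \<open>c\<close> past powers of \<open>b\<close>.
\<close>
lemma (in group) commuting_commutator_pow:
  assumes [simp]: "a \<in> carrier G" "b \<in> carrier G" "c \<in> carrier G"
    and ab: "a \<otimes> b = c \<otimes> (b \<otimes> a)" and cb: "c \<otimes> b = b \<otimes> c"
  shows "a \<otimes> b [^] (n::nat) = c [^] n \<otimes> (b [^] n \<otimes> a)"
proof (induction n)
  case 0
  then show ?case by simp
next
  case (Suc n)
  have bc: "b [^] n \<otimes> c = c \<otimes> b [^] n"
    by (rule group_commutes_pow) (use cb in auto)
  have "a \<otimes> b [^] Suc n = (a \<otimes> b [^] n) \<otimes> b"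
    by (simp add: m_assoc)
  also have "\<dots> = c [^] n \<otimes> (b [^] n \<otimes> (a \<otimes> b))"
    by (simp add: Suc m_assoc)
  also have "\<dots> = c [^] n \<otimes> ((b [^] n \<otimes> c) \<otimes> (b \<otimes> a))"
    by (simp add: ab m_assoc)
  also have "\<dots> = c [^] Suc n \<otimes> (b [^] Suc n \<otimes> a)"
    by (simp add: bc m_assoc)
  finally show ?case .
qed

lemma (in group) central_commutator_pow_eq_one:
  assumes [simp]: "a \<in> carrier G" "b \<in> carrier G" "c \<in> carrier G"
    and "a \<otimes> b = c \<otimes> (b \<otimes> a)" "c \<otimes> b = b \<otimes> c" "b [^] (n::nat) = \<one>"
  shows "c [^] n = \<one>"
proof -
  have "a = c [^] n \<otimes> a"
    using commuting_commutator_pow[OF assms(1-5), of n] assms(6) by simp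
  then show ?thesis
    by (simp add: r_cancel_one')
qed

text \<open>
  A commutator \<open>c\<close> of \<open>a\<close> and \<open>b\<close> that commutes with both is killed by every exponent that kills
  \<open>b\<close>, and by symmetry (its inverse is the commutator of \<open>b\<close> and \<open>a\<close>) by every one that kills \<open>a\<close>.
\<close>
lemma (in group) central_commutator_eq_one:
  assumes [simp]: "a \<in> carrier G" "b \<in> carrier G" "c \<in> carrier G"
    and ab: "a \<otimes> b = c \<otimes> (b \<otimes> a)" and ca: "c \<otimes> a = a \<otimes> c" and cb: "c \<otimes> b = b \<otimes> c"
    and am: "a [^] (m::nat) = \<one>" and bn: "b [^] (n::nat) = \<one>" and "coprime m n"
  shows "c = \<one>"
proof -
  have "c [^] n = \<one>"
    using central_commutator_pow_eq_one[OF assms(1-3) ab cb bn] .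
  moreover have "inv c [^] m = \<one>"
  proof (rule central_commutator_pow_eq_one[of b a _ m])
    show "b \<otimes> a = inv c \<otimes> (a \<otimes> b)"
      by (simp add: ab inv_solve_left)
    show "inv c \<otimes> a = a \<otimes> inv c"
      using ca by (metis assms(1,3) inv_closed inv_solve_left inv_solve_right m_assoc m_closed)
  qed (simp_all add: am)
  then have "c [^] m = \<one>"
    by (simp add: nat_pow_inv)
  ultimately have "ord c dvd m" "ord c dvd n"
    by (simp_all add: pow_eq_id)
  then have "ord c = 1"
    using \<open>coprime m n\<close> by (metis coprime_common_divisor_nat)
  then show ?thesis
    using ord_eq_1[of c] by simp
qed

text \<open>
  Conjugation by \<open>g\<close> sends \<open>[h, k]\<close> to the commutator of the conjugates of \<open>h\<close> and \<open>k\<close>, so for a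
  normal \<open>N\<close> already the generating set is stable under conjugation.
\<close>
lemma (in group) normal_commutator_subgroup:
  assumes "N \<lhd> G"
  shows "commutator_subgroup G N (carrier G) \<lhd> G"
  unfolding commutator_subgroup_def
proof (rule normal_generateI)
  have N: "N \<subseteq> carrier G"
    using assms by (simp add: normal_imp_subgroup subgroup.subset)
  then show "(\<Union>h\<in>N. \<Union>k\<in>carrier G. {h \<otimes> k \<otimes> inv h \<otimes> inv k}) \<subseteq> carrier G"
    by auto
  fix x g
  assume "x \<in> (\<Union>h\<in>N. \<Union>k\<in>carrier G. {h \<otimes> k \<otimes> inv h \<otimes> inv k})" and g [simp]: "g \<in> carrier G"
  then obtain h k where h: "h \<in> N" and k [simp]: "k \<in> carrier G"
    and x: "x = h \<otimes> k \<otimes> inv h \<otimes> inv k" by auto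
  have hc [simp]: "h \<in> carrier G" using h N by auto
  have "g \<otimes> h \<otimes> inv g \<in> N"
    using assms g h by (simp add: normal.inv_op_closed2)
  moreover have cancel: "inv g \<otimes> (g \<otimes> y) = y" if "y \<in> carrier G" for y
    using that by (simp flip: m_assoc)
  have "g \<otimes> x \<otimes> inv g = (g \<otimes> h \<otimes> inv g) \<otimes> (g \<otimes> k \<otimes> inv g) \<otimes> inv (g \<otimes> h \<otimes> inv g)
      \<otimes> inv (g \<otimes> k \<otimes> inv g)"
    by (simp add: x m_assoc inv_mult_group cancel)
  ultimately show "g \<otimes> x \<otimes> inv g \<in> (\<Union>h\<in>N. \<Union>k\<in>carrier G. {h \<otimes> k \<otimes> inv h \<otimes> inv k})"
    by (intro UN_I[of "g \<otimes> h \<otimes> inv g"] UN_I[of "g \<otimes> k \<otimes> inv g"]) auto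
qed

lemma (in group) normal_lower_central: "lower_central G n \<lhd> G"
proof (induction n)
  case 0
  show ?case by (simp add: normal_invI subgroup_self)
qed (simp add: normal_commutator_subgroup)

text \<open>This is the centrality of \<open>N / [N, G]\<close> in \<open>G / [N, G]\<close>.\<close>
lemma (in group) coset_commute_mod_commutator_subgroup:
  assumes N: "N \<lhd> G" and c: "c \<in> N" and g: "g \<in> carrier G"
  shows "commutator_subgroup G N (carrier G) #> (c \<otimes> g) =
    commutator_subgroup G N (carrier G) #> (g \<otimes> c)"
proof -
  let ?M = "commutator_subgroup G N (carrier G)"
  have M: "subgroup ?M G"
    using normal_commutator_subgroup[OF N] by (rule normal_imp_subgroup)
  have cc: "c \<in> carrier G"
    using N c by (meson normal_imp_subgroup subgroup.mem_carrier)
  have "c \<otimes> g \<otimes> inv c \<otimes> inv g \<in> ?M"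
    unfolding commutator_subgroup_def using c g by (auto intro: generate.incl)
  then have "c \<otimes> g \<otimes> inv (g \<otimes> c) \<in> ?M"
    using cc g by (simp add: inv_mult_group m_assoc)
  moreover have "c \<otimes> g = (c \<otimes> g \<otimes> inv (g \<otimes> c)) \<otimes> (g \<otimes> c)"
    using cc g by (simp add: m_assoc)
  ultimately have "c \<otimes> g \<in> ?M #> (g \<otimes> c)"
    using cc g unfolding r_coset_def by auto
  then show ?thesis
    using repr_independence[of "c \<otimes> g" ?M "g \<otimes> c"] M cc g by simp
qed

text \<open>
  The commutator of two elements of coprime orders descends through the whole lower central
  series: each term of the series is central modulo the next one, so
  \<open>central_commutator_eq_one\<close> applies in the corresponding quotient.
\<close>
lemma (in group) coprime_pow_commutator_in_lower_central:
  assumes [simp]: "a \<in> carrier G" "b \<in> carrier G"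
    and am: "a [^] (m::nat) = \<one>" and bn: "b [^] (n::nat) = \<one>" and "coprime m n"
  shows "a \<otimes> b \<otimes> inv a \<otimes> inv b \<in> lower_central G k"
proof (induction k)
  case 0
  show ?case by simp
next
  case (Suc k)
  define N where "N = lower_central G k"
  define M where "M = lower_central G (Suc k)"
  define c where "c = a \<otimes> b \<otimes> inv a \<otimes> inv b"
  have M_eq: "M = commutator_subgroup G N (carrier G)"
    by (simp add: M_def N_def)
  have N: "N \<lhd> G" unfolding N_def by (rule normal_lower_central)
  have M: "M \<lhd> G" unfolding M_def by (rule normal_lower_central)
  have c [simp]: "c \<in> carrier G" by (simp add: c_def)
  have cN: "c \<in> N" using Suc by (simp add: c_def N_def)
  interpret Q: group "G Mod M"
    using M by (rule normal.factorgroup_is_group)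
  interpret h: group_hom G "G Mod M" "\<lambda>x. M #> x"
    using normal.r_coset_hom_Mod[OF M] by unfold_locales
  have mod: "(M #> x) \<otimes>\<^bsub>G Mod M\<^esub> (M #> y) = M #> (x \<otimes> y)"
    if "x \<in> carrier G" "y \<in> carrier G" for x y
    by (rule h.hom_mult[OF that, symmetric])
  have "M #> c = \<one>\<^bsub>G Mod M\<^esub>"
  proof (rule Q.central_commutator_eq_one[OF _ _ _ _ _ _ _ _ \<open>coprime m n\<close>])
    have "a \<otimes> b = c \<otimes> (b \<otimes> a)"
      by (simp add: c_def m_assoc) (simp flip: m_assoc)
    then show "(M #> a) \<otimes>\<^bsub>G Mod M\<^esub> (M #> b) =
        (M #> c) \<otimes>\<^bsub>G Mod M\<^esub> ((M #> b) \<otimes>\<^bsub>G Mod M\<^esub> (M #> a))"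
      by (simp add: mod del: h.hom_mult mult_FactGroup)
    show "(M #> c) \<otimes>\<^bsub>G Mod M\<^esub> (M #> a) = (M #> a) \<otimes>\<^bsub>G Mod M\<^esub> (M #> c)"
      "(M #> c) \<otimes>\<^bsub>G Mod M\<^esub> (M #> b) = (M #> b) \<otimes>\<^bsub>G Mod M\<^esub> (M #> c)"
      using coset_commute_mod_commutator_subgroup[OF N cN, folded M_eq]
      by (simp_all add: mod del: h.hom_mult mult_FactGroup)
    show "(M #> a) [^]\<^bsub>G Mod M\<^esub> m = \<one>\<^bsub>G Mod M\<^esub>" "(M #> b) [^]\<^bsub>G Mod M\<^esub> n = \<one>\<^bsub>G Mod M\<^esub>"
      using h.hom_nat_pow[of a m] h.hom_nat_pow[of b n] am bn by simp_all
  qed (use h.hom_closed in simp_all)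
  then have "M #> c = M" by simp
  then have "c \<in> M"
    using M c by (meson coset_join1 normal_imp_subgroup)
  then show ?case by (simp add: c_def M_def)
qed

lemma nilpotent_coprime_ord_commute:
  fixes G (structure)
  assumes "nilpotent_group G" and a: "a \<in> carrier G" and b: "b \<in> carrier G"
    and "coprime (group.ord G a) (group.ord G b)"
  shows "a \<otimes> b = b \<otimes> a"
proof -
  interpret group G using assms(1) by (simp add: nilpotent_group_def)
  obtain k where "lower_central G k = {\<one>}"
    using assms(1) by (auto simp: nilpotent_group_def)
  then have "a \<otimes> b \<otimes> inv a \<otimes> inv b = \<one>"
    using coprime_pow_commutator_in_lower_central[OF a b _ _ assms(4), of k] a b by simp
  then have "a \<otimes> b \<otimes> inv (b \<otimes> a) = \<one>"
    using a b by (simp add: inv_mult_group m_assoc)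
  then show ?thesis
    using a b by (metis inv_closed inv_equality inv_inv m_closed)
qed

section \<open>Orders of elements\<close>

text \<open>
  If \<open>(xy)\<^sup>k = 1\<close>, then raising this to the power \<open>ord y\<close> eliminates \<open>y\<close> and shows that \<open>ord x\<close>
  divides \<open>k ord y\<close>, hence \<open>k\<close>; likewise for \<open>y\<close>.
\<close>
lemma (in group) ord_mult_coprime:
  assumes xy: "x \<otimes> y = y \<otimes> x" and [simp]: "x \<in> carrier G" "y \<in> carrier G"
    and cop: "coprime (ord x) (ord y)"
  shows "ord (x \<otimes> y) = ord x * ord y"
proof (rule dvd_antisym)
  have dvd: "ord u dvd ord (u \<otimes> v)"
    if uv: "u \<otimes> v = v \<otimes> u" "u \<in> carrier G" "v \<in> carrier G" "coprime (ord u) (ord v)" for u v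
  proof -
    have "\<one> = (u \<otimes> v) [^] (ord (u \<otimes> v) * ord v)"
      by (subst eq_commute, subst pow_eq_id) (use uv in simp_all)
    also have "\<dots> = u [^] (ord (u \<otimes> v) * ord v) \<otimes> v [^] (ord (u \<otimes> v) * ord v)"
      by (rule pow_mult_distrib) (use uv in auto)
    also have "v [^] (ord (u \<otimes> v) * ord v) = \<one>"
      using uv by (simp add: pow_eq_id)
    finally have "ord u dvd ord (u \<otimes> v) * ord v"
      using uv by (simp add: pow_eq_id[symmetric])
    then show ?thesis
      using uv(4) by (simp add: coprime_dvd_mult_left_iff)
  qed
  have "ord x dvd ord (x \<otimes> y)" "ord y dvd ord (x \<otimes> y)"
    using dvd[of x y] dvd[of y x] xy cop by (simp_all add: coprime_commute)
  then show "ord x * ord y dvd ord (x \<otimes> y)"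
    using cop by (simp add: divides_mult)
  show "ord (x \<otimes> y) dvd ord x * ord y"
    by (rule ord_mul_divides) (use xy in auto)
qed

text \<open>
  Cauchy's theorem. Sylow's theorem also yields a subgroup for a power of \<open>p\<close> that is not the
  highest one dividing the group order; for the exponent one, every element of it other than the
  identity has order \<open>p\<close>.
\<close>
lemma (in group) exists_elem_of_prime_ord:
  assumes fin: "finite (carrier G)" and p: "Factorial_Ring.prime p" "p dvd order G"
  obtains a where "a \<in> carrier G" "ord a = p"
proof -
  obtain m where "order G = p ^ 1 * m"
    using p(2) by auto
  then obtain H where H: "subgroup H G" and "card H = p ^ 1"
    using sylow_thm[OF p(1) group_axioms _ fin] by blast
  then have cH: "card H = p" by simp
  then have "H \<noteq> {\<one>}"
    using p(1) by auto
  then obtain a where a: "a \<in> H" "a \<noteq> \<one>"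
    using subgroup.one_closed[OF H] by blast
  then have ac: "a \<in> carrier G"
    using subgroup.mem_carrier[OF H] by simp
  interpret H: group "G\<lparr>carrier := H\<rparr>"
    using H group_axioms by (rule subgroup.subgroup_is_group)
  have "a [^]\<^bsub>G\<lparr>carrier := H\<rparr>\<^esub> order (G\<lparr>carrier := H\<rparr>) = \<one>\<^bsub>G\<lparr>carrier := H\<rparr>\<^esub>"
    using a by (intro H.pow_order_eq_1) simp
  then have "a [^] p = \<one>"
    by (simp add: order_def cH flip: nat_pow_consistent)
  then have "ord a dvd p"
    using ac by (simp add: pow_eq_id)
  moreover have "ord a \<noteq> 1"
    using a ac ord_eq_1 by blast
  ultimately have "ord a = p"
    using p(1) by (meson prime_nat_iff)
  then show thesis
    using that ac by blast
qed

section \<open>Three primes give an asteroidal triple\<close>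

lemma arcs_ends_coprime_graph:
  "(x, y) \<in> arcs_ends (with_proj (coprime_graph G)) \<longleftrightarrow>
    x \<in> carrier G \<and> y \<in> carrier G \<and> x \<noteq> y \<and> coprime (group.ord G x) (group.ord G y)"
  by (simp add: coprime_graph_def)

text \<open>
  The path is \<open>u\<close>, \<open>c\<close>, \<open>a\<close>, \<open>v\<close>: consecutive orders \<open>pq\<close>, \<open>r\<close>, \<open>p\<close>, \<open>qr\<close> are coprime, and each of
  them shares \<open>p\<close> or \<open>r\<close> with the order of \<open>w\<close>. The statement refers to orders alone, so that
  permuting the primes gives all three paths of the triple.
\<close>
lemma path_avoiding_neighbours_of_prime_orders:
  assumes pqr: "Factorial_Ring.prime p" "Factorial_Ring.prime q" "Factorial_Ring.prime r"
      "p \<noteq> q" "q \<noteq> r" "p \<noteq> r"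
    and carr: "u \<in> carrier G" "v \<in> carrier G" "w \<in> carrier G" "a \<in> carrier G" "c \<in> carrier G"
    and ord: "group.ord G u = p * q" "group.ord G v = q * r" "group.ord G w = r * p"
      "group.ord G a = p" "group.ord G c = r"
  shows "path_avoiding_neighbours (with_proj (coprime_graph G)) u v w"
proof -
  have cop: "coprime p q" "coprime q r" "coprime p r"
    using pqr by (simp_all add: primes_coprime)
  have ne: "p \<noteq> 1" "q \<noteq> 1" "r \<noteq> 1" "p \<noteq> 0" "q \<noteq> 0" "r \<noteq> 0"
    using pqr(1-3) by (metis not_prime_1 not_prime_0)+
  have "distinct (map (group.ord G) [u, c, a, v])"
    using pqr ne cop by (auto simp: ord)
  then have "distinct [u, c, a, v]"
    by (rule distinct_map[THEN iffD1, THEN conjunct1])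
  moreover have "vwalk [u, c, a, v] (with_proj (coprime_graph G))"
    using calculation carr cop
    by (intro vwalkI) (auto simp: coprime_graph_def ord coprime_commute)
  moreover have "\<forall>s\<in>set [u, c, a, v]. (w, s) \<notin> arcs_ends (with_proj (coprime_graph G))"
    unfolding arcs_ends_coprime_graph using ne by (auto simp: ord)
  ultimately show ?thesis
    unfolding path_avoiding_neighbours_def vpath_def
    by (intro exI[of _ "[u, c, a, v]"]) auto
qed

lemma three_primes_imp_asteroidal_triple:
  fixes G (structure)
  assumes fin: "finite (carrier G)" and nil: "nilpotent_group G"
    and pqr: "p \<in> prime_divisors_of_order G" "q \<in> prime_divisors_of_order G"
      "r \<in> prime_divisors_of_order G" "p \<noteq> q" "q \<noteq> r" "p \<noteq> r"
  shows "\<exists>x y z. asteroidal_triple (with_proj (coprime_graph G)) x y z"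
proof -
  interpret group G using nil by (simp add: nilpotent_group_def)
  have prime: "Factorial_Ring.prime p" "Factorial_Ring.prime q" "Factorial_Ring.prime r"
    and dvd: "p dvd order G" "q dvd order G" "r dvd order G"
    using pqr by (auto simp: prime_divisors_of_order_def)
  obtain a where a: "a \<in> carrier G" "ord a = p"
    using exists_elem_of_prime_ord[OF fin prime(1) dvd(1)] .
  obtain b where b: "b \<in> carrier G" "ord b = q"
    using exists_elem_of_prime_ord[OF fin prime(2) dvd(2)] .
  obtain c where c: "c \<in> carrier G" "ord c = r"
    using exists_elem_of_prime_ord[OF fin prime(3) dvd(3)] .
  have ord_mult: "ord (g \<otimes> h) = ord g * ord h"
    if "g \<in> carrier G" "h \<in> carrier G" "coprime (ord g) (ord h)" for g h
    using ord_mult_coprime[OF nilpotent_coprime_ord_commute[OF nil that] that] .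
  have cop: "coprime p q" "coprime q r" "coprime r p"
    using pqr prime by (simp_all add: primes_coprime)
  have ord: "ord (a \<otimes> b) = p * q" "ord (b \<otimes> c) = q * r" "ord (c \<otimes> a) = r * p"
    using a b c cop by (simp_all add: ord_mult)
  have carr: "a \<otimes> b \<in> carrier G" "b \<otimes> c \<in> carrier G" "c \<otimes> a \<in> carrier G"
    using a b c by simp_all
  have ne: "p \<noteq> 1" "q \<noteq> 1" "r \<noteq> 1" "p \<noteq> 0" "q \<noteq> 0" "r \<noteq> 0"
    using prime by (metis not_prime_1 not_prime_0)+
  have "distinct (map ord [a \<otimes> b, b \<otimes> c, c \<otimes> a])"
    using pqr ne by (auto simp: ord)
  then have "distinct [a \<otimes> b, b \<otimes> c, c \<otimes> a]"
    by (rule distinct_map[THEN iffD1, THEN conjunct1])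
  moreover have "independent_set (with_proj (coprime_graph G)) {a \<otimes> b, b \<otimes> c, c \<otimes> a}"
    unfolding independent_set_def arcs_ends_coprime_graph
    using carr ne by (auto simp: ord) (simp add: coprime_graph_def)+
  moreover have "path_avoiding_neighbours (with_proj (coprime_graph G)) (a \<otimes> b) (b \<otimes> c) (c \<otimes> a)"
    by (rule path_avoiding_neighbours_of_prime_orders[of p q r _ _ _ _ a c])
      (use prime pqr carr ord a c in auto)
  moreover have "path_avoiding_neighbours (with_proj (coprime_graph G)) (b \<otimes> c) (c \<otimes> a) (a \<otimes> b)"
    by (rule path_avoiding_neighbours_of_prime_orders[of q r p _ _ _ _ b a])
      (use prime pqr carr ord a b in auto)
  moreover have "path_avoiding_neighbours (with_proj (coprime_graph G)) (a \<otimes> b) (c \<otimes> a) (b \<otimes> c)"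
    by (rule path_avoiding_neighbours_of_prime_orders[of q p r _ _ _ _ b c])
      (use prime pqr carr ord b c in \<open>auto simp: mult.commute\<close>)
  ultimately show ?thesis
    unfolding asteroidal_triple_def by blast
qed

section \<open>An asteroidal triple gives three primes\<close>

text \<open>
  The witness is the second vertex of the path. It differs from \<open>t\<close>, being a neighbour of \<open>u\<close>, so
  its failure to be adjacent to \<open>t\<close> is a common factor of the orders.
\<close>
lemma path_avoiding_neighbours_first_step:
  assumes "path_avoiding_neighbours (with_proj (coprime_graph G)) u v t"
    and "u \<noteq> v" "u \<noteq> t" "(u, t) \<notin> arcs_ends (with_proj (coprime_graph G))" "t \<in> carrier G"
  obtains w where "w \<in> carrier G" "coprime (group.ord G u) (group.ord G w)"
    "\<not> coprime (group.ord G t) (group.ord G w)"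
proof -
  let ?\<Gamma> = "with_proj (coprime_graph G)"
  obtain xs where xs: "vwalk xs ?\<Gamma>" "hd xs = u" "last xs = v" "\<forall>s\<in>set xs. (t, s) \<notin> arcs_ends ?\<Gamma>"
    using assms(1) by (auto simp: path_avoiding_neighbours_def vpath_def)
  obtain w ws where "xs = u # w # ws"
    using xs(1-3) assms(2) by (cases xs rule: vwalk_arcs.cases) (auto simp: vwalk_def)
  then have "(u, w) \<in> arcs_ends ?\<Gamma>" "(t, w) \<notin> arcs_ends ?\<Gamma>"
    using xs by (auto simp: vwalk_def)
  moreover have "t \<noteq> w"
    using calculation assms(4) by auto
  ultimately show thesis
    using assms(5) unfolding arcs_ends_coprime_graph by (intro that[of w]) simp_all
qed

lemma asteroidal_triple_imp_three_primes:
  assumes "group G" and fin: "finite (carrier G)"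
    and AT: "asteroidal_triple (with_proj (coprime_graph G)) x y z"
  shows "card (prime_divisors_of_order G) \<ge> 3"
proof -
  interpret group G by fact
  let ?\<pi> = "prime_divisors_of_order G"
  have indep: "(u, v) \<notin> arcs_ends (with_proj (coprime_graph G))"
    if "u \<in> {x, y, z}" "v \<in> {x, y, z}" for u v
    using AT that by (auto simp: asteroidal_triple_def independent_set_def)
  have carr: "x \<in> carrier G" "y \<in> carrier G" "z \<in> carrier G"
    using AT by (auto simp: asteroidal_triple_def independent_set_def coprime_graph_def)
  have dist: "x \<noteq> y" "y \<noteq> z" "x \<noteq> z"
    using AT by (auto simp: asteroidal_triple_def)
  have in_\<pi>: "p \<in> ?\<pi>" if "Factorial_Ring.prime p" "p dvd ord g" "g \<in> carrier G" for p g
    using that ord_dvd_group_order by (auto simp: prime_divisors_of_order_def intro: dvd_trans)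
  have common: "\<exists>p. Factorial_Ring.prime p \<and> p dvd m \<and> p dvd n" if "\<not> coprime m n" for m n :: nat
    using that by (metis coprime_iff_gcd_eq_1 gcd_nat.boundedE prime_factor_nat)
  have not_both: "\<not> (p dvd m \<and> p dvd n)" if "Factorial_Ring.prime p" "coprime m n" for p m n :: nat
    using that by (metis coprime_common_divisor_nat not_prime_1)
  obtain w where w: "w \<in> carrier G" "coprime (ord y) (ord w)" "\<not> coprime (ord x) (ord w)"
    using path_avoiding_neighbours_first_step[of G y z x] AT indep carr dist
    by (auto simp: asteroidal_triple_def)
  obtain w' where w': "w' \<in> carrier G" "coprime (ord x) (ord w')" "\<not> coprime (ord z) (ord w')"
    using path_avoiding_neighbours_first_step[of G x y z] AT indep carr dist
    by (auto simp: asteroidal_triple_def)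
  have "\<not> coprime (ord x) (ord y)"
    using indep[of x y, unfolded arcs_ends_coprime_graph] carr dist by simp
  \<comment> \<open>\<open>p\<close> and \<open>q\<close> differ because \<open>ord y\<close> and \<open>ord w\<close> are coprime, and \<open>r\<close> differs from both
    because they divide \<open>ord x\<close> and it divides \<open>ord w'\<close>, which is coprime to \<open>ord x\<close>.\<close>
  then obtain p where p: "Factorial_Ring.prime p" "p dvd ord x" "p dvd ord y"
    using common by blast
  obtain q where q: "Factorial_Ring.prime q" "q dvd ord x" "q dvd ord w"
    using common w(3) by blast
  obtain r where r: "Factorial_Ring.prime r" "r dvd ord z" "r dvd ord w'"
    using common w'(3) by blast
  have "p \<noteq> q" "p \<noteq> r" "q \<noteq> r"
    using not_both p q r w(2) w'(2) by blast+
  then have "card {p, q, r} = 3"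
    by simp
  moreover have "{p, q, r} \<subseteq> ?\<pi>"
    using in_\<pi> p q r carr by blast
  moreover have "finite ?\<pi>"
  proof -
    have "order G > 0"
      using fin by (simp add: order_gt_0_iff_finite)
    then show ?thesis
      unfolding prime_divisors_of_order_def by (auto intro: finite_subset[of _ "{..order G}"] dest: dvd_imp_le)
  qed
  ultimately show ?thesis
    by (metis card_mono)
qed

theorem theorem10:
  fixes G :: "('a, 'b) monoid_scheme"
  assumes "finite (carrier G)" and "nilpotent_group G"
  shows "AT_free (with_proj (coprime_graph G)) \<longleftrightarrow> card (prime_divisors_of_order G) < 3"
proof
  assume AT_free: "AT_free (with_proj (coprime_graph G))"
  show "card (prime_divisors_of_order G) < 3"
  proof (rule ccontr)
    assume "\<not> card (prime_divisors_of_order G) < 3"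
    then obtain T where "T \<subseteq> prime_divisors_of_order G" "card T = 3"
      by (meson not_less obtain_subset_with_card_n)
    then obtain p q r where "{p, q, r} \<subseteq> prime_divisors_of_order G" "p \<noteq> q" "q \<noteq> r" "p \<noteq> r"
      by (auto simp: card_3_iff)
    then show False
      using three_primes_imp_asteroidal_triple[OF assms, of p q r] AT_free
      by (auto simp: AT_free_def)
  qed
next
  assume "card (prime_divisors_of_order G) < 3"
  then show "AT_free (with_proj (coprime_graph G))"
    using asteroidal_triple_imp_three_primes[OF _ assms(1)] assms(2)
    by (fastforce simp: AT_free_def nilpotent_group_def)
qed

end
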